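(* For every integer $n\ge 0$, $$\sum_{\lambda\in\mathcal{PDO}(2n)} x^{\ell_d(\lambda)} = \sum_{k=0}^{n}\left(\sum_{\mu\in\mathcal{PDO}(k)}x^{\ell_d(\mu)}\right)\left(\sum_{\nu\in\mathcal{PDO}(n-k)}x^{\ell_d(\nu)}\right)$$ as polynomials in $x$. Equivalently, writing $PDO(x,q):=\sum_{\lambda\in\mathcal{PDO}}x^{\ell_d(\lambda)}q^{|\lambda|}$, we have for all $n\ge 0$ $$[q^{2n}]\,PDO(x,q) = [q^n]\left(PDO(x,q)\right)^2.$$
   Context: A PDO partition (partition into odd parts with designated summands) of a nonnegative integer $n$ is an integer partition of $n$ all of whose parts are odd, together with a choice, for each part size that occurs, of exactly one of its occurrences (the "designated" one). Occurrences of the same part size are distinguished by position, so a part size occurring $t$ times can be designated in $t$ ways; e.g. $1'+1$ and $1+1'$ are two different PDO partitions of $2$. The weight $|\lambda|$ is the sum of all parts of $\lambda$. $\mathcal{PDO}(n)$ is the set of all PDO partitions of $n$, with $\mathcal{PDO}(0)$ consisting of the empty partition only, and $\mathcal{PDO}:=\bigcup_{n\ge0}\mathcal{PDO}(n)$. For $\lambda\in\mathcal{PDO}$, $\ell_d(\lambda)$ is the number of different part sizes occurring in $\lambda$. $[q^n]F$ denotes the coefficient of $q^n$ in the formal power series $F$ in $q$ (here with coefficients in $\mathbb{Z}[x]$). *)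

theory Defs
  imports
    "HOL-Computational_Algebra.Polynomial"
    "HOL-Computational_Algebra.Formal_Power_Series"
begin

text \<open>
  A PDO partition is a pair \<open>(ps, D)\<close>: \<open>ps\<close> is the weakly decreasing list of parts and \<open>D\<close> is
  the set of positions (indices into \<open>ps\<close>) of the designated parts.  Parts are positive because
  they are odd.
\<close>

type_synonym pdo_partition = "nat list \<times> nat set"

definition is_PDO :: "pdo_partition \<Rightarrow> bool" where
  "is_PDO lam \<longleftrightarrow> (case lam of (ps, D) \<Rightarrow>
     sorted_wrt (\<ge>) ps \<and>
     (\<forall>p\<in>set ps. odd p) \<and>
     D \<subseteq> {..<length ps} \<and>
     (\<forall>p\<in>set ps. \<exists>!i. i \<in> D \<and> ps ! i = p))"

definition weight :: "pdo_partition \<Rightarrow> nat" where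
  "weight lam = sum_list (fst lam)"

definition ell_d :: "pdo_partition \<Rightarrow> nat" where
  "ell_d lam = card (set (fst lam))"

definition PDO :: "nat \<Rightarrow> pdo_partition set" where
  "PDO n = {lam. is_PDO lam \<and> weight lam = n}"

definition PDO_all :: "pdo_partition set" where
  "PDO_all = (\<Union>n. PDO n)"

text \<open>
  The sum of \<open>x ^ ell_d lam * q ^ weight lam\<close> over all PDO partitions, as a power series in \<open>q\<close> over
  \<open>\<int>[x]\<close>.  The sum is infinite, but only finitely many summands contribute to each power of \<open>q\<close>
  (lemma \<open>finite_PDO\<close>), so it is formed coefficientwise.
\<close>

definition PDO_gf :: "int poly fps" where
  "PDO_gf = Abs_fps (\<lambda>m. \<Sum>lam\<in>{lam \<in> PDO_all. weight lam = m}. monom 1 (ell_d lam))"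

lemma finite_PDO: "finite (PDO n)"
proof -
  have len: "length ps \<le> sum_list ps" if "\<forall>p\<in>set ps. odd p" for ps :: "nat list"
    using that
  proof (induction ps)
    case (Cons a ps)
    then have "a > 0" by (auto intro: Nat.gr0I)
    with Cons show ?case by simp
  qed simp
  have "PDO n \<subseteq> {ps. set ps \<subseteq> {..n} \<and> length ps \<le> n} \<times> Pow {..<n}"
  proof
    fix lam
    assume "lam \<in> PDO n"
    then obtain ps D where *: "lam = (ps, D)" "\<forall>p\<in>set ps. odd p" "D \<subseteq> {..<length ps}"
      "sum_list ps = n"
      by (cases lam) (simp add: PDO_def is_PDO_def weight_def)
    have "length ps \<le> n" using len[OF *(2)] *(4) by simp
    moreover have "set ps \<subseteq> {..n}" using member_le_sum_list *(4) by blast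
    moreover have "D \<subseteq> {..<n}" using *(3) \<open>length ps \<le> n\<close> by auto
    ultimately show "lam \<in> {ps. set ps \<subseteq> {..n} \<and> length ps \<le> n} \<times> Pow {..<n}"
      using *(1) by simp
  qed
  then show ?thesis
    by (rule finite_subset) (intro finite_cartesian_product finite_lists_length_le; simp)
qed

end

theory Submission
  imports Defs
begin

text \<open>
  The generating function is the product over odd \<open>p\<close> of \<open>1 + x * q^p / (1 - q^p)\<^sup>2\<close>.  With
  \<open>x = 2 + w + 1/w\<close> the factor equals \<open>(1 + w * q^p) * (1 + q^p / w) / (1 - q^p)\<^sup>2\<close>, so the Jacobi
  triple product turns it into \<open>\<theta>(w, q) / \<theta>(-1, q)\<close> where \<open>\<theta>(w, q)\<close> is the sum of
  \<open>w^j * q^(j\<^sup>2)\<close> over all integers \<open>j\<close>.  Multiply numerator and denominator by \<open>\<theta>(1, q)\<close>.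
  Rotating the lattice, \<open>(s, t) \<mapsto> (s + t, s - t)\<close>, shows that the even part of
  \<open>\<theta>(w, q) * \<theta>(1, q)\<close> is \<open>\<theta>(w, q\<^sup>2)\<^sup>2\<close>, and \<open>\<theta>(-1, q) * \<theta>(1, q)\<close> has no odd part.
  Hence the even part of the generating function is its square with \<open>q\<close> replaced by \<open>q\<^sup>2\<close>.
  As the Jacobi identity needs a coefficient ring containing \<open>w\<close>, the polynomial identity is
  checked at integers \<open>x\<close>, with \<open>w\<close> complex.
\<close>

unbundle fps_syntax

section \<open>Gaussian binomials and the finite Jacobi triple product\<close>

text \<open>Gaussian binomials through one q-Pascal rule: no division, so any commutative ring will
  do, in particular with \<open>q = fps_X\<^sup>2\<close>.\<close>

fun qbinom :: "'a::comm_ring_1 \<Rightarrow> nat \<Rightarrow> nat \<Rightarrow> 'a" where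
  "qbinom q n 0 = 1"
| "qbinom q 0 (Suc k) = 0"
| "qbinom q (Suc n) (Suc k) = qbinom q n k + q ^ Suc k * qbinom q n (Suc k)"

lemma qbinom_eq_0: "n < k \<Longrightarrow> qbinom q n k = 0"
  by (induction q n k rule: qbinom.induct) auto

lemma qbinom_Suc_Suc':
  "k \<le> n \<Longrightarrow> qbinom q (Suc n) (Suc k) = q ^ (n - k) * qbinom q n k + qbinom q n (Suc k)"
proof (induction n arbitrary: k)
  case (Suc n)
  show ?case
  proof (cases k)
    case 0
    then show ?thesis
      using Suc.IH[of 0] by (simp add: algebra_simps)
  next
    case (Suc k')
    consider "k \<le> n" | "k = Suc n"
      using Suc.prems by linarith
    then show ?thesis
    proof cases
      case 1
      then have "n - k' = Suc (n - k)" "n - k + k = n"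
        using Suc by auto
      have pow: "q ^ k * q ^ (n - k) = q ^ n"
        using 1 by (simp flip: power_add)
      have "qbinom q (Suc (Suc n)) (Suc k) = qbinom q (Suc n) k + q ^ Suc k * qbinom q (Suc n) (Suc k)"
        by simp
      also have "\<dots> = q ^ Suc (n - k) * qbinom q n k' + qbinom q n k
          + q ^ Suc k * (q ^ (n - k) * qbinom q n k + qbinom q n (Suc k))"
        using Suc.IH[of k] Suc.IH[of k'] 1 Suc \<open>n - k' = _\<close> by simp
      also have "\<dots> = q ^ Suc (n - k) * (qbinom q n k' + q ^ k * qbinom q n k)
          + (qbinom q n k + q ^ Suc k * qbinom q n (Suc k))"
        by (simp add: algebra_simps)
      also have "\<dots> = q ^ (Suc n - k) * qbinom q (Suc n) k + qbinom q (Suc n) (Suc k)"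
        using 1 by (simp add: Suc Suc_diff_le del: diff_Suc_Suc)
      finally show ?thesis .
    next
      case 2
      then show ?thesis
        by (simp add: qbinom_eq_0)
    qed
  qed
qed simp

text \<open>Both q-Pascal rules expand \<open>qbinom q (Suc n) (Suc k)\<close>; comparing them gives
  the difference of neighbours.\<close>

lemma qbinom_Suc_diff:
  assumes "k \<le> n"
  shows "qbinom q n (Suc k) - qbinom q n k
    = q ^ Suc k * qbinom q n (Suc k) - q ^ (n - k) * qbinom q n k"
  using qbinom_Suc_Suc'[OF assms, of q] by (simp add: algebra_simps)

lemma dvd_qbinom_Suc_diff:
  assumes "m \<le> Suc k" "m + k \<le> n"
  shows "q ^ m dvd qbinom q n (Suc k) - qbinom q n k"
proof -
  have "q ^ m dvd q ^ Suc k" "q ^ m dvd q ^ (n - k)"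
    using assms by (intro le_imp_power_dvd; simp)+
  then show ?thesis
    using assms by (simp only: qbinom_Suc_diff dvd_diff dvd_mult2)
qed

text \<open>Walk outward from the centre and telescope: the step from distance \<open>d\<close> to
  \<open>d + 1\<close> is divisible by \<open>q ^ (n - d)\<close>, so each step costs one power of
  \<open>q\<close>.\<close>

lemma dvd_qbinom_diff_central:
  assumes "d \<le> n"
  shows "q ^ (Suc n - d) dvd qbinom q (2 * n) (n + d) - qbinom q (2 * n) n"
    and "q ^ (Suc n - d) dvd qbinom q (2 * n) (n - d) - qbinom q (2 * n) n"
  using assms
proof (induction d)
  case (Suc d)
  have pow: "q ^ (n - d) dvd q ^ (Suc n - d)"
    by (intro le_imp_power_dvd) simp
  {
    case 1
    have "q ^ (n - d) dvd qbinom q (2 * n) (n + d) - qbinom q (2 * n) n"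
      using pow Suc.IH(1) 1 by (blast intro: dvd_trans Suc_leD)
    moreover have "q ^ (n - d) dvd qbinom q (2 * n) (Suc (n + d)) - qbinom q (2 * n) (n + d)"
      using 1 by (intro dvd_qbinom_Suc_diff) auto
    ultimately have "q ^ (n - d) dvd qbinom q (2 * n) (Suc (n + d)) - qbinom q (2 * n) (n + d)
        + (qbinom q (2 * n) (n + d) - qbinom q (2 * n) n)"
      by (intro dvd_add)
    then show ?case
      by simp
  next
    case 2
    have *: "q ^ (n - d) dvd qbinom q (2 * n) (n - d) - qbinom q (2 * n) n"
      using pow Suc.IH(2) 2 by (blast intro: dvd_trans Suc_leD)
    have "q ^ (n - d) dvd qbinom q (2 * n) (Suc (n - Suc d)) - qbinom q (2 * n) (n - Suc d)"
      using 2 by (intro dvd_qbinom_Suc_diff) auto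
    then have "q ^ (n - d) dvd qbinom q (2 * n) (n - d) - qbinom q (2 * n) (n - Suc d)"
      using 2 by (simp add: Suc_diff_Suc)
    from dvd_diff[OF * this] show ?case
      by simp
  }
qed auto

lemma dvd_qbinom_central:
  assumes "i \<le> 2 * n"
  shows "q ^ (Suc n - nat \<bar>int i - int n\<bar>) dvd qbinom q (2 * n) i - qbinom q (2 * n) n"
proof (cases "n \<le> i")
  case True
  then show ?thesis
    using dvd_qbinom_diff_central(1)[of "i - n" n q] assms by (simp add: nat_diff_distrib)
next
  case False
  then show ?thesis
    using dvd_qbinom_diff_central(2)[of "n - i" n q] assms by (simp add: nat_diff_distrib)
qed

text \<open>A new factor of the second product calls for the defining q-Pascal rule, one of the
  first for the mirrored rule \<open>qbinom_Suc_Suc'\<close>. The factors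
  \<open>w + q ^ (2*k+1)\<close> avoid an inverse of \<open>w\<close>, which moves the centre of the
  squares to \<open>b\<close>.\<close>

lemma finite_jacobi_triple_product:
  fixes w q :: "'a::comm_ring_1"
  shows "(\<Prod>k<a. 1 + w * q ^ (2*k+1)) * (\<Prod>k<b. w + q ^ (2*k+1))
    = (\<Sum>i\<le>a+b. w ^ i * q ^ nat ((int i - int b)\<^sup>2) * qbinom (q\<^sup>2) (a + b) i)"
proof (induction a)
  case 0
  show ?case
  proof (induction b)
    case (Suc b)
    \<comment> \<open>Moving the centre from \<open>b\<close> to \<open>b + 1\<close> releases
      exactly the power of \<open>q\<^sup>2\<close> in the defining rule.\<close>
    have e: "q ^ (2*b+1) * q ^ nat ((int i - int b)\<^sup>2)
        = q ^ nat ((int i - int (Suc b))\<^sup>2) * (q\<^sup>2) ^ i" for i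
    proof -
      have "2*b+1 + nat ((int i - int b)\<^sup>2) = nat ((int i - int (Suc b))\<^sup>2) + 2 * i"
        unfolding int_int_eq[symmetric]
        by (simp only: of_nat_add of_nat_mult nat_0_le zero_le_power2)
           (simp add: power2_eq_square algebra_simps)
      then show ?thesis
        by (simp only: flip: power_add power_mult)
    qed
    have "(\<Prod>k<Suc b. w + q ^ (2*k+1))
       = (w + q ^ (2*b+1)) * (\<Sum>i\<le>b. w ^ i * q ^ nat ((int i - int b)\<^sup>2) * qbinom (q\<^sup>2) b i)"
      using Suc by (simp add: mult.commute)
    also have "\<dots> = (\<Sum>i\<le>b. w ^ Suc i * q ^ nat ((int i - int b)\<^sup>2) * qbinom (q\<^sup>2) b i)
       + (\<Sum>i\<le>b. w ^ i * (q ^ (2*b+1) * q ^ nat ((int i - int b)\<^sup>2)) * qbinom (q\<^sup>2) b i)"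
      by (simp add: algebra_simps sum_distrib_left sum.distrib)
    also have "(\<Sum>i\<le>b. w ^ i * (q ^ (2*b+1) * q ^ nat ((int i - int b)\<^sup>2)) * qbinom (q\<^sup>2) b i)
      = (\<Sum>i\<le>Suc b. w ^ i * q ^ nat ((int i - int (Suc b))\<^sup>2) * ((q\<^sup>2) ^ i * qbinom (q\<^sup>2) b i))"
      unfolding e by (simp add: qbinom_eq_0 mult.assoc)
    also have "\<dots> = q ^ nat ((int 0 - int (Suc b))\<^sup>2) +
       (\<Sum>i\<le>b. w ^ Suc i * q ^ nat ((int i - int b)\<^sup>2) * ((q\<^sup>2) ^ Suc i * qbinom (q\<^sup>2) b (Suc i)))"
      by (subst sum.atMost_Suc_shift) simp
    also have "(\<Sum>i\<le>b. w ^ Suc i * q ^ nat ((int i - int b)\<^sup>2) * qbinom (q\<^sup>2) b i) + \<dots>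
      = q ^ nat ((int 0 - int (Suc b))\<^sup>2) +
        (\<Sum>i\<le>b. w ^ Suc i * q ^ nat ((int i - int b)\<^sup>2) * qbinom (q\<^sup>2) (Suc b) (Suc i))"
      by (simp add: sum.distrib distrib_left)
    also have "\<dots> = (\<Sum>i\<le>Suc b. w ^ i * q ^ nat ((int i - int (Suc b))\<^sup>2) * qbinom (q\<^sup>2) (Suc b) i)"
      by (subst sum.atMost_Suc_shift) simp
    finally show ?case
      by simp
  qed simp
next
  case (Suc a)
  let ?f = "\<lambda>i. q ^ nat ((int i - int b)\<^sup>2)"
  let ?G = "qbinom (q\<^sup>2) (a + b)"
  \<comment> \<open>Raising the index by one releases the power of \<open>q\<^sup>2\<close> in the
    mirrored rule.\<close>
  have e: "q ^ (2*a+1) * ?f i = ?f (Suc i) * (q\<^sup>2) ^ (a + b - i)" if "i \<le> a + b" for i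
  proof -
    have "2*a+1 + nat ((int i - int b)\<^sup>2) = nat ((int (Suc i) - int b)\<^sup>2) + 2 * (a + b - i)"
      using that unfolding int_int_eq[symmetric]
      by (simp only: of_nat_add of_nat_mult of_nat_diff nat_0_le zero_le_power2)
         (simp add: power2_eq_square algebra_simps)
    then show ?thesis
      by (simp only: flip: power_add power_mult)
  qed
  have "(\<Prod>k<Suc a. 1 + w * q ^ (2*k+1)) * (\<Prod>k<b. w + q ^ (2*k+1))
     = (1 + w * q ^ (2*a+1)) * ((\<Prod>k<a. 1 + w * q ^ (2*k+1)) * (\<Prod>k<b. w + q ^ (2*k+1)))"
    by (simp add: algebra_simps)
  also have "\<dots> = (\<Sum>i\<le>a+b. w ^ i * ?f i * ?G i) + (\<Sum>i\<le>a+b. w ^ Suc i * (q ^ (2*a+1) * ?f i) * ?G i)"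
    unfolding Suc by (simp add: algebra_simps sum_distrib_left sum.distrib)
  also have "(\<Sum>i\<le>a+b. w ^ i * ?f i * ?G i) = (\<Sum>i\<le>Suc (a+b). w ^ i * ?f i * ?G i)"
    by (simp add: qbinom_eq_0)
  also have "\<dots> = ?f 0 + (\<Sum>i\<le>a+b. w ^ Suc i * ?f (Suc i) * ?G (Suc i))"
    by (subst sum.atMost_Suc_shift) simp
  also have "(\<Sum>i\<le>a+b. w ^ Suc i * (q ^ (2*a+1) * ?f i) * ?G i)
     = (\<Sum>i\<le>a+b. w ^ Suc i * ?f (Suc i) * ((q\<^sup>2) ^ (a + b - i) * ?G i))"
    by (intro sum.cong) (simp_all only: e atMost_iff mult.assoc)
  also have "?f 0 + (\<Sum>i\<le>a+b. w ^ Suc i * ?f (Suc i) * ?G (Suc i)) + \<dots>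
     = ?f 0 + (\<Sum>i\<le>a+b. w ^ Suc i * ?f (Suc i) * qbinom (q\<^sup>2) (Suc (a+b)) (Suc i))"
    by (simp only: add.assoc flip: sum.distrib)
       (intro arg_cong2[of _ _ _ _ "(+)"] refl sum.cong,
        simp only: qbinom_Suc_Suc' atMost_iff, simp only: algebra_simps)
  also have "\<dots> = (\<Sum>i\<le>Suc (a+b). w ^ i * ?f i * qbinom (q\<^sup>2) (Suc (a+b)) i)"
    by (subst sum.atMost_Suc_shift) simp
  finally show ?case
    by simp
qed

section \<open>Theta series\<close>

text \<open>Turns agreement up to \<open>O(q ^ n)\<close> into divisibility, where units can be
  cancelled.\<close>

lemma fps_X_power_dvd_iff:
  fixes f :: "'a::comm_ring_1 fps"
  shows "fps_X ^ n dvd f \<longleftrightarrow> (\<forall>i<n. f $ i = 0)"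
proof
  assume "fps_X ^ n dvd f"
  then show "\<forall>i<n. f $ i = 0"
    by (auto simp: fps_X_power_mult_nth elim!: dvdE)
next
  assume "\<forall>i<n. f $ i = 0"
  then have "f = fps_X ^ n * fps_shift n f"
    by (intro fps_ext) (simp add: fps_X_power_mult_nth)
  then show "fps_X ^ n dvd f"
    by (rule dvdI)
qed

lemma fps_nth_0_qbinom:
  fixes q :: "'a::comm_ring_1 fps"
  shows "q $ 0 = 0 \<Longrightarrow> k \<le> n \<Longrightarrow> qbinom q n k $ 0 = 1"
  by (induction q n k rule: qbinom.induct) auto

definition theta :: "'a::field \<Rightarrow> 'a fps" where
  "theta w = Abs_fps (\<lambda>n. \<Sum>j | j\<^sup>2 = int n. w powi j)"

lemma finite_squares: "finite {j::int. j\<^sup>2 = m}"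
proof (rule finite_subset)
  show "{j::int. j\<^sup>2 = m} \<subseteq> {-\<bar>m\<bar>..\<bar>m\<bar>}"
  proof
    fix j :: int assume "j \<in> {j. j\<^sup>2 = m}"
    then have "\<bar>j\<bar> * 1 \<le> \<bar>j\<bar> * \<bar>j\<bar>" if "j \<noteq> 0"
      using that by (intro mult_left_mono) auto
    then show "j \<in> {-\<bar>m\<bar>..\<bar>m\<bar>}"
      using \<open>j \<in> _\<close> by (cases "j = 0") (auto simp: power2_eq_square)
  qed
qed simp

text \<open>The finite sum has the terms \<open>w ^ N * w powi j\<close> with
  \<open>\<bar>j\<bar> \<le> N\<close>; the first missing exponent is
  \<open>(N + 1)\<^sup>2 > 2 * N\<close>.\<close>

lemma theta_truncate:
  fixes w :: "'a::field"
  assumes "w \<noteq> 0"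
  shows "fps_X ^ (2*N+1) dvd
    (\<Sum>i\<le>2*N. fps_const w ^ i * fps_X ^ nat ((int i - int N)\<^sup>2)) - fps_const w ^ N * theta w"
  unfolding fps_X_power_dvd_iff
proof (intro allI impI)
  fix n assume n: "n < 2 * N + 1"
  have "(\<Sum>i\<le>2*N. fps_const w ^ i * fps_X ^ nat ((int i - int N)\<^sup>2)) $ n
      = (\<Sum>i | i \<le> 2 * N \<and> (int i - int N)\<^sup>2 = int n. w ^ i)"
    by (auto simp: fps_sum_nth fps_const_power nat_eq_iff2 split: if_splits
        intro!: sum.mono_neutral_cong_right)
  also have "\<dots> = (\<Sum>j | j\<^sup>2 = int n. w ^ N * w powi j)"
  proof (rule sum.reindex_bij_witness[where i = "\<lambda>j. nat (j + int N)" and j = "\<lambda>i. int i - int N"])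
    fix j assume j: "j \<in> {j. j\<^sup>2 = int n}"
    have *: "\<bar>j\<bar> \<le> int N"
    proof (rule ccontr)
      assume "\<not> \<bar>j\<bar> \<le> int N"
      then have "(int N + 1)\<^sup>2 \<le> \<bar>j\<bar>\<^sup>2"
        by (intro power_mono) auto
      then show False
        using j n zero_le_power2[of "int N"] by (simp add: power2_sum)
    qed
    then show "int (nat (j + int N)) - int N = j"
      by simp
    show "nat (j + int N) \<in> {i. i \<le> 2 * N \<and> (int i - int N)\<^sup>2 = int n}"
      using j * by auto
  next
    fix i assume "i \<in> {i. i \<le> 2 * N \<and> (int i - int N)\<^sup>2 = int n}"
    show "w ^ N * w powi (int i - int N) = w ^ i"
      using assms by (simp add: power_int_diff)
  qed auto
  also have "\<dots> = (fps_const w ^ N * theta w) $ n"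
    by (simp add: theta_def fps_const_power sum_distrib_left)
  finally show "((\<Sum>i\<le>2*N. fps_const w ^ i * fps_X ^ nat ((int i - int N)\<^sup>2))
      - fps_const w ^ N * theta w) $ n = 0"
    by simp
qed

text \<open>
  The Gaussian binomials tend to the central one fast enough that, up to \<open>O(q ^ (2*N+1))\<close>, the
  central one is a common factor: the term of index \<open>j\<close> is affected from
  \<open>j\<^sup>2 + 2 * (N + 1 - \<bar>j\<bar>) > 2 * N\<close> on.
\<close>

lemma jacobi_triple_product_truncated:
  fixes w :: "'a::field"
  assumes "w \<noteq> 0"
  shows "fps_X ^ (2*N+1) dvd
    (\<Prod>k<N. 1 + fps_const w * fps_X ^ (2*k+1)) * (\<Prod>k<N. 1 + fps_const (inverse w) * fps_X ^ (2*k+1))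
      - theta w * qbinom (fps_X\<^sup>2) (2*N) N"
proof -
  let ?X = "fps_X :: 'a fps" and ?w = "fps_const w" and ?G = "qbinom ((fps_X :: 'a fps)\<^sup>2) (2 * N)"
  let ?P = "(\<Prod>k<N. 1 + ?w * ?X ^ (2*k+1)) * (\<Prod>k<N. 1 + fps_const (inverse w) * ?X ^ (2*k+1))"
  have unit: "?w ^ N dvd 1"
    using assms by (simp add: fps_const_power)
  have "?w + ?X ^ m = ?w * (1 + fps_const (inverse w) * ?X ^ m)" for m
    using assms by (simp add: algebra_simps flip: mult.assoc)
  then have "?w ^ N * ?P = (\<Prod>k<N. 1 + ?w * ?X ^ (2*k+1)) * (\<Prod>k<N. ?w + ?X ^ (2*k+1))"
    by (simp only: prod.distrib) (simp add: mult_ac)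
  also have "\<dots> = (\<Sum>i\<le>2*N. ?w ^ i * ?X ^ nat ((int i - int N)\<^sup>2) * ?G i)"
    unfolding finite_jacobi_triple_product by (simp add: mult_2)
  \<comment> \<open>Two errors: replacing each Gaussian binomial by the central one, and truncating
    the theta series.\<close>
  finally have split: "?w ^ N * (?P - theta w * ?G N)
      = (\<Sum>i\<le>2*N. ?w ^ i * ?X ^ nat ((int i - int N)\<^sup>2) * (?G i - ?G N))
      + ((\<Sum>i\<le>2*N. ?w ^ i * ?X ^ nat ((int i - int N)\<^sup>2)) - ?w ^ N * theta w) * ?G N"
    by (simp add: algebra_simps sum_subtractf sum_distrib_right sum_distrib_left)
  have "?X ^ (2*N+1) dvd ?w ^ i * ?X ^ nat ((int i - int N)\<^sup>2) * (?G i - ?G N)"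
    if "i \<le> 2 * N" for i
  proof -
    define d where "d = nat \<bar>int i - int N\<bar>"
    have d: "d \<le> N" "int d = \<bar>int i - int N\<bar>"
      using that unfolding d_def by auto
    have sq: "nat ((int i - int N)\<^sup>2) = d\<^sup>2"
      unfolding int_int_eq[symmetric] of_nat_power d(2) by simp
    have "2 * N + 1 \<le> d\<^sup>2 + 2 * (Suc N - d)"
    proof -
      \<comment> \<open>The two sides differ by \<open>(d - 1)\<^sup>2\<close>.\<close>
      have "int (2 * N + 1) \<le> int (d\<^sup>2 + 2 * (Suc N - d))"
        using d(1) zero_le_power2[of "int d - 1"] by (simp add: of_nat_diff power2_eq_square algebra_simps)
      then show ?thesis
        by (simp only: of_nat_le_iff)
    qed
    then have "?X ^ (2*N+1) dvd ?X ^ d\<^sup>2 * (?X\<^sup>2) ^ (Suc N - d)"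
      by (simp only: flip: power_add power_mult) (rule le_imp_power_dvd)
    also have "?X ^ d\<^sup>2 * (?X\<^sup>2) ^ (Suc N - d) dvd ?X ^ d\<^sup>2 * (?G i - ?G N)"
      using dvd_qbinom_central[OF that, of "?X\<^sup>2"] unfolding d_def by (intro mult_dvd_mono) auto
    finally show ?thesis
      unfolding mult.assoc sq by (rule dvd_mult)
  qed
  then have "?X ^ (2*N+1) dvd ?w ^ N * (?P - theta w * ?G N)"
    unfolding split by (intro dvd_add dvd_sum dvd_mult2[OF theta_truncate[OF assms]]) (simp only: atMost_iff)
  then show ?thesis
    using unit by (simp only: dvd_mult_unit_iff')
qed

text \<open>For \<open>p > 0\<close> this is \<open>q ^ p / (1 - q ^ p)\<^sup>2\<close>: the
  coefficient \<open>t\<close> at \<open>q ^ (t * p)\<close> counts the ways to designate one of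
  \<open>t\<close> copies of \<open>p\<close>.\<close>

definition dseries :: "nat \<Rightarrow> 'a::comm_ring_1 fps" where
  "dseries p = Abs_fps (\<lambda>n. if p dvd n then of_nat (n div p) else 0)"

lemma dseries_mult:
  assumes "p > 0"
  shows "dseries p * (1 - fps_X ^ p)\<^sup>2 = (fps_X ^ p :: 'a::comm_ring_1 fps)"
proof -
  \<comment> \<open>The series of \<open>q ^ p / (1 - q ^ p)\<close>, reached after one
    multiplication by \<open>1 - fps_X ^ p\<close>.\<close>
  let ?H = "Abs_fps (\<lambda>n. if p dvd n \<and> n > 0 then 1 else 0 :: 'a)"
  have "(fps_X ^ p * dseries p) $ n = dseries p $ n - ?H $ n" for n
    using assms
    by (auto simp: fps_X_power_mult_nth dseries_def dvd_minus_self le_div_geq elim!: dvdE)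
  then have 1: "(1 - fps_X ^ p) * dseries p = ?H"
    by (intro fps_ext) (simp add: algebra_simps)
  have 2: "(1 - fps_X ^ p) * ?H = fps_X ^ p"
    using assms
    by (intro fps_ext) (auto simp: left_diff_distrib fps_X_power_mult_nth dvd_minus_self dvd_imp_le)
  have "dseries p * (1 - fps_X ^ p)\<^sup>2 = (1 - fps_X ^ p) * ((1 - fps_X ^ p) * dseries p :: 'a fps)"
    by (simp add: power2_eq_square mult_ac)
  also have "\<dots> = fps_X ^ p"
    unfolding 1 2 ..
  finally show ?thesis .
qed

text \<open>The third assumption encodes an infinite product without limits. The truncated triple
  products at \<open>w\<close> and \<open>-1\<close> share the central Gaussian binomial, which has
  constant term 1 and cancels as a unit.\<close>

lemma prod_dseries_mult_theta:
  fixes w x :: "'a::field" and S :: "'a fps"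
  assumes w: "w \<noteq> 0" and x: "x = 2 + w + inverse w"
    and S: "\<And>N n. n \<le> 2 * N \<Longrightarrow> S $ n = (\<Prod>k<N. 1 + fps_const x * dseries (2*k+1)) $ n"
  shows "S * theta (-1) = theta w"
proof (rule fps_ext)
  fix n :: nat
  define N where "N = n"
  let ?X = "fps_X :: 'a fps" and ?G = "qbinom ((fps_X :: 'a fps)\<^sup>2) (2 * N) N"
  let ?A = "\<lambda>w. (\<Prod>k<N. 1 + fps_const w * ?X ^ (2*k+1)) *
    (\<Prod>k<N. 1 + fps_const (inverse w) * ?X ^ (2*k+1))"
  let ?P = "\<Prod>k<N. 1 + fps_const x * dseries (2*k+1)"
  \<comment> \<open>At \<open>-1\<close> the two factors form
    \<open>(1 - fps_X ^ p)\<^sup>2\<close>, the denominator of \<open>dseries p\<close>.\<close>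
  have factor: "(1 + fps_const w * ?X ^ p) * (1 + fps_const (inverse w) * ?X ^ p)
      = (1 + fps_const x * dseries p) *
        ((1 + fps_const (-1) * ?X ^ p) * (1 + fps_const (inverse (-1)) * ?X ^ p))" if "p > 0" for p
  proof -
    have "(1 + fps_const w * ?X ^ p) * (1 + fps_const (inverse w) * ?X ^ p)
        = (1 - ?X ^ p)\<^sup>2 + fps_const x * ?X ^ p"
    proof -
      have c: "fps_const x = 2 + fps_const w + fps_const (inverse w)"
        unfolding x by (simp flip: fps_const_add add: numeral_fps_const)
      have "(1 + fps_const w * ?X ^ p) * (1 + fps_const (inverse w) * ?X ^ p)
          = 1 + (fps_const w + fps_const (inverse w)) * ?X ^ p
            + fps_const w * fps_const (inverse w) * (?X ^ p)\<^sup>2"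
        by (simp only: power2_eq_square distrib_left distrib_right mult_1_left mult_1_right add_ac mult_ac)
      also have "fps_const w * fps_const (inverse w) = 1"
        using w by simp
      finally show ?thesis
        unfolding c by (simp add: power2_eq_square algebra_simps del: fps_const_add)
    qed
    also have "\<dots> = (1 + fps_const x * dseries p) * (1 - ?X ^ p)\<^sup>2"
      using dseries_mult[OF that, where 'a = 'a] by (simp add: distrib_right mult.assoc)
    also have "1 - ?X ^ p = 1 + fps_const (-1) * ?X ^ p"
      by (simp flip: fps_const_neg)
    finally show ?thesis
      by (simp only: power2_eq_square inverse_minus_eq inverse_1)
  qed
  have A: "?A w = ?P * ?A (-1)"
    unfolding prod.distrib[symmetric] by (intro prod.cong refl factor) simp
  \<comment> \<open>Three errors, each divisible by \<open>fps_X ^ (2*N+1)\<close>: the two triple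
    products and the truncation of \<open>S\<close>.\<close>
  have "(theta w - S * theta (-1)) * ?G
      = ?P * (?A (-1) - theta (-1) * ?G) - (?A w - theta w * ?G) - (S - ?P) * (theta (-1) * ?G)"
    unfolding A by (simp add: algebra_simps)
  moreover have "?X ^ (2*N+1) dvd S - ?P"
    unfolding fps_X_power_dvd_iff using S by simp
  ultimately have "?X ^ (2*N+1) dvd (theta w - S * theta (-1)) * ?G"
    using jacobi_triple_product_truncated[OF w, of N] jacobi_triple_product_truncated[of "-1 :: 'a" N]
    by (simp only: dvd_diff dvd_mult dvd_mult2 neg_equal_0_iff_equal one_neq_zero not_False_eq_True)
  moreover have "?G dvd 1"
    using fps_nth_0_qbinom[of "?X\<^sup>2" N "2 * N"] by simp
  ultimately have "?X ^ (2*N+1) dvd theta w - S * theta (-1)"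
    by (simp only: dvd_mult_unit_iff)
  then show "(S * theta (-1)) $ n = theta w $ n"
    unfolding fps_X_power_dvd_iff N_def by simp
qed

section \<open>Products of theta series as sums over lattice points\<close>

lemma theta_mult_nth:
  "(theta u * theta v) $ n = (\<Sum>(a, b) | a\<^sup>2 + b\<^sup>2 = int n. u powi a * v powi b)"
proof -
  have "(theta u * theta v) $ n = (\<Sum>i=0..n. \<Sum>(a, b) \<in> {a. a\<^sup>2 = int i} \<times> {b. b\<^sup>2 = int (n - i)}.
      u powi a * v powi b)"
    by (simp add: theta_def fps_mult_nth sum_product sum.cartesian_product)
  also have "\<dots> = (\<Sum>(i, a, b) \<in> (SIGMA i:{0..n}. {a. a\<^sup>2 = int i} \<times> {b. b\<^sup>2 = int (n - i)}).
      u powi a * v powi b)"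
    by (subst sum.Sigma) (auto intro!: finite_squares)
  also have "\<dots> = (\<Sum>(a, b) | a\<^sup>2 + b\<^sup>2 = int n. u powi a * v powi b)"
  proof -
    have "nat (a\<^sup>2) \<le> n \<and> b\<^sup>2 = int (n - nat (a\<^sup>2))" if "a\<^sup>2 + b\<^sup>2 = int n" for a b :: int
      using that zero_le_power2[of a] zero_le_power2[of b] by linarith
    then show ?thesis
      by (intro sum.reindex_bij_witness[where i = "\<lambda>(a, b). (nat (a\<^sup>2), a, b)" and j = snd])
         (auto simp: of_nat_diff)
  qed
  finally show ?thesis .
qed

text \<open>An even \<open>a\<^sup>2 + b\<^sup>2\<close> forces equal parity, so the point is
  \<open>(s + t, s - t)\<close> with norm \<open>2 * (s\<^sup>2 + t\<^sup>2)\<close>, and the weight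
  \<open>w powi (s + t)\<close> factors.\<close>

lemma theta_mult_theta_1_even:
  assumes "w \<noteq> 0"
  shows "(theta w * theta 1) $ (2 * n) = (theta w * theta w) $ n"
proof -
  have lattice: "\<exists>s t. a = s + t \<and> b = s - t" if "a\<^sup>2 + b\<^sup>2 = int (2 * n)" for a b :: int
  proof -
    have "even (a\<^sup>2 + b\<^sup>2)"
      unfolding that by simp
    then have "even (a + b)"
      by simp
    then obtain s where "a + b = 2 * s"
      by (elim evenE)
    then have "a = s + (s - b)" "b = s - (s - b)"
      by auto
    then show ?thesis
      by blast
  qed
  show ?thesis
    unfolding theta_mult_nth
  proof (rule sum.reindex_bij_witness[symmetric, where j = "\<lambda>(s, t). (s + t, s - t)"
        and i = "\<lambda>(a, b). ((a + b) div 2, (a - b) div 2)"])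
    fix ab :: "int \<times> int" assume "ab \<in> {(a, b). a\<^sup>2 + b\<^sup>2 = int (2 * n)}"
    then obtain s t where st: "ab = (s + t, s - t)" "(s + t)\<^sup>2 + (s - t)\<^sup>2 = int (2 * n)"
      using lattice by force
    show "(case case ab of (a, b) \<Rightarrow> ((a + b) div 2, (a - b) div 2) of (s, t) \<Rightarrow> (s + t, s - t)) = ab"
      unfolding st(1) by simp
    show "(case ab of (a, b) \<Rightarrow> ((a + b) div 2, (a - b) div 2)) \<in> {(a, b). a\<^sup>2 + b\<^sup>2 = int n}"
      using st(2) unfolding st(1) by (simp add: power2_eq_square algebra_simps)
  qed (use assms in \<open>auto simp: power2_eq_square algebra_simps power_int_add\<close>)
qed

text \<open>Exactly one coordinate of a point of odd norm is odd, so swapping coordinates flips the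
  sign and the sum is its own negative.\<close>

lemma theta_minus_1_mult_theta_1_odd:
  "(theta (-1 :: 'a::field_char_0) * theta 1) $ (2 * n + 1) = 0"
proof -
  let ?A = "{(a, b). a\<^sup>2 + b\<^sup>2 = int (2 * n + 1)}"
  have s: "(theta (-1 :: 'a) * theta 1) $ (2 * n + 1) = (\<Sum>(a, b)\<in>?A. (-1) powi a)"
    unfolding theta_mult_nth by simp
  also have "\<dots> = (\<Sum>(a, b)\<in>?A. - ((-1) powi a))"
  proof (rule sum.reindex_bij_witness[where i = prod.swap and j = prod.swap])
    fix p assume "p \<in> ?A"
    then obtain a b where p: "p = (a, b)" "a\<^sup>2 + b\<^sup>2 = int (2 * n + 1)"
      by auto
    have "odd (a\<^sup>2 + b\<^sup>2)"
      unfolding p(2) by simp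
    then have "even a \<longleftrightarrow> odd b"
      by simp
    then show "(case prod.swap p of (a, b) \<Rightarrow> - ((-1) powi a)) = (case p of (a, b) \<Rightarrow> (-1 :: 'a) powi a)"
      using p(1) by (auto simp: power_int_minus_left)
  qed auto
  also have "\<dots> = - (\<Sum>(a, b)\<in>?A. (-1) powi a)"
    by (simp add: sum_negf case_prod_unfold)
  finally show ?thesis
    unfolding s by simp
qed

text \<open>As \<open>h\<close> is \<open>g\<close> with \<open>q\<close> replaced by
  \<open>q\<^sup>2\<close>, even coefficients of \<open>f * h\<close> involve only even coefficients
  of \<open>f\<close>.\<close>

lemma fps_mult_even_nth:
  fixes f g h :: "'a::comm_ring_1 fps"
  assumes "\<And>k. h $ (2 * k + 1) = 0" "\<And>k. h $ (2 * k) = g $ k"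
  shows "(f * h) $ (2 * n) = (Abs_fps (\<lambda>k. f $ (2 * k)) * g) $ n"
proof -
  have "(f * h) $ (2 * n) = (\<Sum>i\<in>(*) 2 ` {0..n}. f $ i * h $ (2 * n - i))"
    unfolding fps_mult_nth
  proof (intro sum.mono_neutral_right ballI)
    fix i assume "i \<in> {0..2 * n} - (*) 2 ` {0..n}"
    then have "odd i" "i \<le> 2 * n"
      by (auto elim!: evenE)
    then obtain k where "2 * n - i = 2 * k + 1"
      by (metis dvd_triv_left oddE odd_add le_add_diff_inverse)
    then show "f $ i * h $ (2 * n - i) = 0"
      using assms(1) by simp
  qed auto
  also have "\<dots> = (\<Sum>i=0..n. f $ (2 * i) * h $ (2 * (n - i)))"
    by (subst sum.reindex) (auto simp: inj_on_def right_diff_distrib')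
  finally show ?thesis
    by (simp add: fps_mult_nth assms(2))
qed

text \<open>Take \<open>h = theta (-1) * theta 1\<close>, whose even part is
  \<open>(theta (-1))\<^sup>2\<close>, and read the even coefficients of
  \<open>S * h = theta w * theta 1\<close> in two ways.\<close>

lemma even_part_eq_square:
  fixes w :: "'a::field_char_0" and S :: "'a fps"
  assumes w: "w \<noteq> 0" and S: "S * theta (-1) = theta w"
  shows "S $ (2 * n) = (S\<^sup>2) $ n"
proof -
  let ?E = "Abs_fps (\<lambda>k. S $ (2 * k))"
  have "?E * (theta (-1))\<^sup>2 = S\<^sup>2 * (theta (-1))\<^sup>2"
  proof (rule fps_ext)
    fix n
    have "(?E * (theta (-1))\<^sup>2) $ n = (S * (theta (-1) * theta 1)) $ (2 * n)"
      by (rule fps_mult_even_nth[symmetric])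
         (simp_all add: theta_minus_1_mult_theta_1_odd[simplified] theta_mult_theta_1_even power2_eq_square)
    also have "\<dots> = (theta w * theta 1) $ (2 * n)"
      by (simp add: S flip: mult.assoc)
    also have "\<dots> = ((S * theta (-1)) * (S * theta (-1))) $ n"
      unfolding S by (rule theta_mult_theta_1_even[OF w])
    also have "\<dots> = (S\<^sup>2 * (theta (-1))\<^sup>2) $ n"
      by (simp add: power2_eq_square mult_ac)
    finally show "(?E * (theta (-1))\<^sup>2) $ n = (S\<^sup>2 * (theta (-1))\<^sup>2) $ n" .
  qed
  \<comment> \<open>Only \<open>j = 0\<close> contributes to the constant term; hence
    \<open>theta (-1)\<close> is nonzero and cancels.\<close>
  moreover have "theta (-1 :: 'a) $ 0 = 1"
    by (simp add: theta_def)
  then have "theta (-1 :: 'a) \<noteq> 0"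
    by (metis fps_zero_nth zero_neq_one)
  ultimately have "?E = S\<^sup>2"
    by simp
  then show ?thesis
    by (metis fps_nth_Abs_fps)
qed

section \<open>The generating function as a product\<close>

definition PDO_below :: "nat \<Rightarrow> nat \<Rightarrow> pdo_partition set" where
  "PDO_below m n = {lam \<in> PDO n. \<forall>p\<in>set (fst lam). p < m}"

text \<open>Meant for \<open>p\<close> above all parts of \<open>lam\<close>: prepending then keeps
  the list weakly decreasing, and old positions move up by \<open>t\<close>.\<close>

definition add_part :: "nat \<Rightarrow> nat \<Rightarrow> nat \<Rightarrow> pdo_partition \<Rightarrow> pdo_partition" where
  "add_part p t i lam = (replicate t p @ fst lam, insert i ((+) t ` snd lam))"

lemma add_part_in_PDO_below:
  assumes lam: "lam \<in> PDO_below p n" and t: "i < t" and p: "odd p" "p < m"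
  shows "add_part p t i lam \<in> PDO_below m (t * p + n)"
proof -
  obtain ps D where lam_eq: "lam = (ps, D)"
    by (cases lam)
  have ps: "sorted_wrt (\<ge>) ps" "\<And>a. a \<in> set ps \<Longrightarrow> odd a" "\<And>a. a \<in> set ps \<Longrightarrow> a < p"
    "D \<subseteq> {..<length ps}" "\<And>a. a \<in> set ps \<Longrightarrow> \<exists>!i. i \<in> D \<and> ps ! i = a" "sum_list ps = n"
    using lam unfolding PDO_below_def PDO_def is_PDO_def weight_def lam_eq by auto
  let ?ps = "replicate t p @ ps" and ?D = "insert i ((+) t ` D)"
  have designated: "\<exists>!j. j \<in> ?D \<and> ?ps ! j = a" if a: "a \<in> set ?ps" for a
  proof (cases "a = p")
    case True
    have "ps ! k \<noteq> p" if "k \<in> D" for k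
      using ps(3)[OF nth_mem, of k] ps(4) that by auto
    then show ?thesis
      using t True by (intro ex1I[of _ i]) (auto simp: nth_append)
  next
    case False
    then have "a \<in> set ps"
      using a by (auto split: if_splits)
    from ps(5)[OF this] obtain k where k: "k \<in> D" "ps ! k = a"
      by blast
    have unique: "j = k" if "j \<in> D" "ps ! j = a" for j
      using ps(5)[OF \<open>a \<in> set ps\<close>] that k by blast
    show ?thesis
      using k False t by (intro ex1I[of _ "t + k"]) (auto simp: nth_append dest: unique)
  qed
  have "sorted_wrt (\<ge>) (replicate t p)"
    by (induction t) auto
  then have "is_PDO (?ps, ?D)"
    unfolding is_PDO_def prod.case using ps(1-4) p t
    by (intro conjI ballI designated) (auto simp: sorted_wrt_append less_imp_le)
  moreover have "\<forall>a\<in>set ?ps. a < m"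
    using ps(3) p(2) less_trans by auto
  ultimately show ?thesis
    using ps(6) by (simp add: PDO_below_def PDO_def weight_def add_part_def lam_eq sum_list_replicate)
qed

lemma ell_d_add_part:
  assumes "lam \<in> PDO_below p n" "i < t"
  shows "ell_d (add_part p t i lam) = Suc (ell_d lam)"
proof -
  have "p \<notin> set (fst lam)"
    using assms unfolding PDO_below_def by auto
  moreover have "set (fst (add_part p t i lam)) = insert p (set (fst lam))"
    using assms(2) by (auto simp: add_part_def)
  ultimately show ?thesis
    by (simp add: ell_d_def)
qed

text \<open>As \<open>p\<close> is not a part of \<open>lam\<close>, \<open>t\<close> is recovered
  by counting copies of \<open>p\<close>, \<open>i\<close> as the only designated position below
  \<open>t\<close>, and \<open>lam\<close> by stripping the prefix.\<close>

lemma add_part_inject: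
  assumes "lam \<in> PDO_below p n" "lam' \<in> PDO_below p n'" "i < t" "i' < t'"
    and eq: "add_part p t i lam = add_part p t' i' lam'"
  shows "t = t'" "i = i'" "lam = lam'"
proof -
  have "p \<notin> set (fst lam)" "p \<notin> set (fst lam')"
    using assms unfolding PDO_below_def by auto
  then have "length (filter ((=) p) (fst (add_part p t i lam))) = t"
    "length (filter ((=) p) (fst (add_part p t' i' lam'))) = t'"
    by (auto simp: add_part_def filter_empty_conv)
  then show t: "t = t'"
    using eq by simp
  have "snd (add_part p t i lam) \<inter> {..<t} = {i}" "snd (add_part p t' i' lam') \<inter> {..<t'} = {i'}"
    using assms by (auto simp: add_part_def)
  then show "i = i'"
    using eq t by auto
  have *: "(\<lambda>j. t + j) -` snd (add_part p t j mu) = snd mu" if "j < t" for j mu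
    using that by (auto simp: add_part_def)
  have "snd lam = snd lam'"
    using *[of i lam] *[of i' lam'] assms t by simp
  moreover have "fst lam = fst lam'"
    using eq t by (simp add: add_part_def)
  ultimately show "lam = lam'"
    by (rule prod_eqI[rotated])
qed

lemma sorted_wrt_ge_max_prefix:
  fixes ps :: "nat list"
  assumes "sorted_wrt (\<ge>) ps" "\<And>a. a \<in> set ps \<Longrightarrow> a \<le> p"
  obtains t qs where "ps = replicate t p @ qs" "\<And>a. a \<in> set qs \<Longrightarrow> a < p"
proof -
  have "\<exists>t qs. ps = replicate t p @ qs \<and> (\<forall>a\<in>set qs. a < p)"
    using assms
  proof (induction ps)
    case (Cons b ps)
    then obtain t qs where IH: "ps = replicate t p @ qs" "\<forall>a\<in>set qs. a < p"
      by auto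
    show ?case
    proof (cases "b = p")
      case True
      then show ?thesis
        using IH by (intro exI[of _ "Suc t"] exI[of _ qs]) simp
    next
      case False
      then have "b < p" "\<forall>a\<in>set ps. a \<le> b"
        using Cons.prems by (auto simp: order_le_less)
      then show ?thesis
        by (intro exI[of _ 0] exI[of _ "b # ps"]) auto
    qed
  qed simp
  then show thesis
    using that by blast
qed

text \<open>The copies of \<open>p\<close> form an initial block; an empty block is the first case,
  and otherwise removing it inverts \<open>add_part\<close>.\<close>

lemma PDO_below_cases:
  assumes mu: "mu \<in> PDO_below (p + 2) n" and p: "odd p"
  obtains "mu \<in> PDO_below p n"
  | t i lam where "mu = add_part p t i lam" "i < t" "t * p \<le> n" "lam \<in> PDO_below p (n - t * p)"
proof -
  obtain ps D where mu_eq: "mu = (ps, D)"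
    by (cases mu)
  have ps: "sorted_wrt (\<ge>) ps" "\<And>a. a \<in> set ps \<Longrightarrow> odd a" "\<And>a. a \<in> set ps \<Longrightarrow> a < p + 2"
    "D \<subseteq> {..<length ps}" "\<And>a. a \<in> set ps \<Longrightarrow> \<exists>!i. i \<in> D \<and> ps ! i = a" "sum_list ps = n"
    using mu unfolding PDO_below_def PDO_def is_PDO_def weight_def mu_eq by auto
  \<comment> \<open>The bound \<open>p + 2\<close> would still admit \<open>p + 1\<close>, but that
    is even.\<close>
  have "a \<le> p" if "a \<in> set ps" for a
    using ps(2,3)[OF that] p by (cases "a = p + 1") auto
  then obtain t qs where qs: "ps = replicate t p @ qs" "\<And>a. a \<in> set qs \<Longrightarrow> a < p"
    using sorted_wrt_ge_max_prefix[OF ps(1)] by blast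
  show thesis
  proof (cases "t = 0")
    case True
    then show thesis
      using mu qs by (intro that(1)) (auto simp: PDO_below_def mu_eq)
  next
    case False
    then have "p \<in> set ps"
      using qs by simp
    from ps(5)[OF this] obtain i where i: "i \<in> D" "ps ! i = p"
      by blast
    have i_unique: "j = i" if "j \<in> D" "ps ! j = p" for j
      using ps(5)[OF \<open>p \<in> set ps\<close>] that i by blast
    \<comment> \<open>Beyond the block all entries are below \<open>p\<close>, so the designated
      copy of \<open>p\<close> lies inside it.\<close>
    have "i < t"
    proof (rule ccontr)
      assume "\<not> i < t"
      then have "qs ! (i - t) = p" "i - t < length qs"
        using i ps(4) qs(1) by (auto simp: nth_append)
      then show False
        using qs(2)[OF nth_mem] by blast
    qed
    \<comment> \<open>Undoes the shift by \<open>t\<close>; among the positions below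
      \<open>t\<close>, all holding \<open>p\<close>, only \<open>i\<close> is designated.\<close>
    let ?E = "(\<lambda>j. t + j) -` D"
    have D: "D = insert i ((+) t ` ?E)"
    proof (intro equalityI subsetI)
      fix j assume j: "j \<in> D"
      show "j \<in> insert i ((+) t ` ?E)"
      proof (cases "j < t")
        case True
        then show ?thesis
          using i_unique[OF j] qs(1) by (simp add: nth_append)
      next
        case False
        then show ?thesis
          using j by (auto intro!: image_eqI[of _ _ "j - t"])
      qed
    qed (use i in auto)
    have "\<exists>!j. j \<in> ?E \<and> qs ! j = a" if a: "a \<in> set qs" for a
    proof -
      have "a \<in> set ps"
        using a qs(1) by simp
      from ps(5)[OF this] obtain k where k: "k \<in> D" "ps ! k = a"
        by blast
      have k_unique: "j = k" if "j \<in> D" "ps ! j = a" for j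
        using ps(5)[OF \<open>a \<in> set ps\<close>] that k by blast
      have "t \<le> k"
        using k(2) qs(1) qs(2)[OF a] by (force simp: nth_append not_less[symmetric])
      have "j = k - t" if "j \<in> ?E" "qs ! j = a" for j
        using k_unique[of "t + j"] that qs(1) by (simp add: nth_append)
      then show ?thesis
        using k \<open>t \<le> k\<close> qs(1) by (intro ex1I[of _ "k - t"]) (auto simp: nth_append)
    qed
    moreover have "t * p + sum_list qs = n"
      using ps(6) qs(1) by (simp add: sum_list_replicate)
    ultimately have "(qs, ?E) \<in> PDO_below p (n - t * p)"
      using ps qs unfolding PDO_below_def PDO_def is_PDO_def weight_def
      by (auto simp: sorted_wrt_append)
    moreover have "mu = add_part p t i (qs, ?E)"
      using D qs(1) by (simp add: add_part_def mu_eq)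
    ultimately show thesis
      using \<open>i < t\<close> \<open>t * p + sum_list qs = n\<close> by (intro that(2)) auto
  qed
qed

text \<open>Here \<open>x\<close> is a ring element and not an indeterminate, so that it can later
  be a complex number.\<close>

definition PDO_below_gf :: "'a::comm_ring_1 \<Rightarrow> nat \<Rightarrow> 'a fps" where
  "PDO_below_gf x m = Abs_fps (\<lambda>n. \<Sum>lam\<in>PDO_below m n. x ^ ell_d lam)"

lemma finite_PDO_below: "finite (PDO_below m n)"
  using finite_PDO by (rule finite_subset[rotated]) (auto simp: PDO_below_def)

text \<open>A partition with parts up to \<open>p\<close> avoids \<open>p\<close> or arises from a
  unique triple \<open>(t, i, lam)\<close> by \<open>add_part\<close>; the new part size contributes
  one factor \<open>x\<close>.\<close>

lemma PDO_below_gf_step: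
  fixes x :: "'a::comm_ring_1"
  assumes p: "odd p"
  shows "PDO_below_gf x (p + 2) = PDO_below_gf x p * (1 + fps_const x * dseries p)"
proof (rule fps_ext)
  fix n
  let ?T = "SIGMA t:{t. t * p \<le> n}. {..<t} \<times> PDO_below p (n - t * p)"
  let ?f = "\<lambda>(t, i, lam). add_part p t i lam"
  have p0: "p > 0"
    using p by (rule odd_pos)
  have fin: "finite {t. t * p \<le> n}"
  proof (rule finite_subset)
    have "t \<le> t * p" for t
      using p0 by simp
    then show "{t. t * p \<le> n} \<subseteq> {..n}"
      using order_trans by blast
  qed simp
  have "add_part p t i lam \<in> PDO_below (p + 2) n"
    if "t * p \<le> n" "i < t" "lam \<in> PDO_below p (n - t * p)" for t i lam
    using add_part_in_PDO_below[OF that(3,2) p, of "p + 2"] that(1) by simp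
  then have "?f ` ?T \<subseteq> PDO_below (p + 2) n"
    by auto
  moreover have "PDO_below p n \<subseteq> PDO_below (p + 2) n"
    by (auto simp: PDO_below_def)
  moreover have "PDO_below (p + 2) n \<subseteq> PDO_below p n \<union> ?f ` ?T"
  proof
    fix mu assume "mu \<in> PDO_below (p + 2) n"
    then show "mu \<in> PDO_below p n \<union> ?f ` ?T"
      using p by (cases rule: PDO_below_cases) force+
  qed
  ultimately have un: "PDO_below (p + 2) n = PDO_below p n \<union> ?f ` ?T"
    by blast
  \<comment> \<open>\<open>i < t\<close> forces \<open>t > 0\<close>, so everything in the image
    contains \<open>p\<close>.\<close>
  have disj: "PDO_below p n \<inter> ?f ` ?T = {}"
    by (auto simp: PDO_below_def add_part_def)
  have inj: "inj_on ?f ?T"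
    by (rule inj_onI) (auto dest: add_part_inject)
  have "PDO_below_gf x (p + 2) $ n = (\<Sum>lam\<in>PDO_below p n. x ^ ell_d lam) + (\<Sum>mu\<in>?f ` ?T. x ^ ell_d mu)"
    using fin disj unfolding PDO_below_gf_def un fps_nth_Abs_fps
    by (intro sum.union_disjoint) (auto intro!: finite_PDO_below)
  also have "(\<Sum>mu\<in>?f ` ?T. x ^ ell_d mu) = (\<Sum>(t, i, lam)\<in>?T. x * x ^ ell_d lam)"
    by (subst sum.reindex[OF inj]) (auto intro!: sum.cong simp: ell_d_add_part)
  \<comment> \<open>The summand does not depend on \<open>i\<close>, so the \<open>t\<close>
    positions give the factor \<open>of_nat t\<close>.\<close>
  also have "\<dots> = (\<Sum>t | t * p \<le> n. of_nat t * x * PDO_below_gf x p $ (n - t * p))"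
    by (subst sum.Sigma[symmetric])
       (auto intro!: fin finite_PDO_below
         simp: PDO_below_gf_def sum_distrib_left mult.assoc simp flip: sum.cartesian_product)
  also have "\<dots> = (\<Sum>j\<in>(\<lambda>t. t * p) ` {t. t * p \<le> n}. x * dseries p $ j * PDO_below_gf x p $ (n - j))"
    using p0 by (subst sum.reindex) (auto simp: inj_on_def dseries_def mult_ac)
  also have "\<dots> = (\<Sum>j=0..n. x * dseries p $ j * PDO_below_gf x p $ (n - j))"
    by (intro sum.mono_neutral_left) (auto simp: dseries_def mult.commute elim!: dvdE)
  also have "\<dots> = (fps_const x * dseries p * PDO_below_gf x p) $ n"
    by (simp add: mult.assoc fps_mult_nth[of "dseries p"] sum_distrib_left)
  also have "(\<Sum>lam\<in>PDO_below p n. x ^ ell_d lam) = PDO_below_gf x p $ n"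
    by (simp add: PDO_below_gf_def)
  finally show "PDO_below_gf x (p + 2) $ n = (PDO_below_gf x p * (1 + fps_const x * dseries p)) $ n"
    by (simp add: algebra_simps)
qed

lemma PDO_below_gf_eq_prod:
  "PDO_below_gf x (2 * N + 1) = (\<Prod>k<N. 1 + fps_const x * dseries (2*k+1))"
proof (induction N)
  case 0
  \<comment> \<open>No odd number lies below 1, which leaves only the empty partition.\<close>
  have "PDO_below 1 n = (if n = 0 then {([], {})} else {})" for n
  proof (rule equalityI; rule subsetI)
    fix lam assume lam: "lam \<in> PDO_below 1 n"
    have "p = 0 \<and> odd p" if "p \<in> set (fst lam)" for p
      using that lam by (auto simp: PDO_below_def PDO_def is_PDO_def split: prod.splits)
    then have "fst lam = []"
      by (metis even_zero last_in_set)
    then show "lam \<in> (if n = 0 then {([], {})} else {})"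
      using lam by (cases lam) (auto simp: PDO_below_def PDO_def is_PDO_def weight_def)
  qed (auto simp: PDO_below_def PDO_def is_PDO_def weight_def split: if_splits)
  then show ?case
    by (intro fps_ext) (simp add: PDO_below_gf_def ell_d_def)
next
  case (Suc N)
  then show ?case
    using PDO_below_gf_step[of "2 * N + 1" x] by (simp add: mult.commute)
qed

lemma PDO_below_eq_PDO:
  assumes "n < m"
  shows "PDO_below m n = PDO n"
proof -
  have "p < m" if "lam \<in> PDO n" "p \<in> set (fst lam)" for p lam
    using member_le_sum_list[OF that(2)] that(1) assms by (simp add: PDO_def weight_def)
  then show ?thesis
    by (auto simp: PDO_below_def)
qed

section \<open>The even part\<close>

text \<open>Take for \<open>w\<close> a root of \<open>w\<^sup>2 - (x - 2) * w + 1\<close>; the two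
  roots have product 1, so the other one is its inverse.\<close>

lemma ex_add_inverse:
  fixes x :: complex
  obtains w where "w \<noteq> 0" "x = 2 + w + inverse w"
proof -
  define s where "s = csqrt ((x - 2)\<^sup>2 - 4)"
  define w where "w = (x - 2 + s) / 2"
  have "s\<^sup>2 = (x - 2)\<^sup>2 - 4"
    unfolding s_def by simp
  then have "w * ((x - 2 - s) / 2) = 1"
    unfolding w_def by (simp add: power2_eq_square field_simps)
  moreover from this have "inverse w = (x - 2 - s) / 2"
    by (rule inverse_unique)
  ultimately show thesis
    by (intro that[of w]) (auto simp: w_def field_simps)
qed

lemma PDO_even_sum_complex:
  fixes x :: complex
  shows "(\<Sum>lam\<in>PDO (2 * n). x ^ ell_d lam)
    = (\<Sum>k=0..n. (\<Sum>\<mu>\<in>PDO k. x ^ ell_d \<mu>) * (\<Sum>\<nu>\<in>PDO (n - k). x ^ ell_d \<nu>))"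
proof -
  let ?S = "Abs_fps (\<lambda>m. \<Sum>lam\<in>PDO m. x ^ ell_d lam)"
  obtain w where w: "w \<noteq> 0" "x = 2 + w + inverse w"
    by (rule ex_add_inverse)
  \<comment> \<open>Parts of a partition of \<open>m \<le> 2 * N\<close> are below
    \<open>2 * N + 1\<close>, so the truncated product already has the right coefficient.\<close>
  have "?S $ m = (\<Prod>k<N. 1 + fps_const x * dseries (2*k+1)) $ m" if "m \<le> 2 * N" for N m
    using that by (simp only: PDO_below_gf_def PDO_below_eq_PDO fps_nth_Abs_fps less_Suc_eq_le Suc_eq_plus1
      flip: PDO_below_gf_eq_prod)
  from even_part_eq_square[OF w(1) prod_dseries_mult_theta[OF w this], of n] show ?thesis
    by (simp add: power2_eq_square fps_mult_nth)
qed

text \<open>Integer polynomials agreeing at all integers are equal, and their values can be compared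
  after embedding them in the complex numbers.\<close>

lemma PDO_even_sum_poly:
  "(\<Sum>lam\<in>PDO (2 * n). monom (1::int) (ell_d lam))
    = (\<Sum>k=0..n. (\<Sum>\<mu>\<in>PDO k. monom (1::int) (ell_d \<mu>)) *
        (\<Sum>\<nu>\<in>PDO (n - k). monom (1::int) (ell_d \<nu>)))" (is "?p = ?q")
proof -
  have "poly ?p x = poly ?q x" for x
  proof -
    have "(of_int (poly ?p x) :: complex) = of_int (poly ?q x)"
      using PDO_even_sum_complex[of "of_int x" n] by (simp add: poly_sum poly_monom)
    then show ?thesis
      by (simp only: of_int_eq_iff)
  qed
  then show ?thesis
    by (simp only: fun_eq_iff flip: poly_eq_poly_eq_iff) simp
qed

theorem theorem1p3:
  fixes n :: nat
  shows "(\<Sum>lam\<in>PDO (2 * n). monom (1::int) (ell_d lam)) =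
           (\<Sum>k=0..n. (\<Sum>\<mu>\<in>PDO k. monom (1::int) (ell_d \<mu>)) *
                      (\<Sum>\<nu>\<in>PDO (n - k). monom (1::int) (ell_d \<nu>))) \<and>
         fps_nth PDO_gf (2 * n) = fps_nth (PDO_gf ^ 2) n"
proof -
  \<comment> \<open>With this, the second conjunct is the first one read through the Cauchy
    product.\<close>
  have "{lam \<in> PDO_all. weight lam = m} = PDO m" for m
    by (auto simp: PDO_all_def PDO_def)
  then show ?thesis
    using PDO_even_sum_poly[of n] by (simp add: PDO_gf_def power2_eq_square fps_mult_nth)
qed

end
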